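(* (a) There are at most countably many homeomorphism classes of spaces $(\mathbb{R},\tau)$ with $\tau\in\mathcal{T}$ and $(\mathbb{R},\tau)$ locally connected. (b) If $\tau\in\mathcal{T}$ and $(\mathbb{R},\tau)$ is locally connected and separable, then there is a real function $F$ with $\tau=\tau[F]$, and the set $\Gamma(\tau)$ is countable and closed in the Euclidean topology.
   Context: $\eta$ denotes the Euclidean topology on $\mathbb{R}$; $\mathcal{T}$ is the family of all topologies on $\mathbb{R}$ finer than $\eta$. $\Gamma(\tau)=\{x\in\mathbb{R}:\mathcal{U}_\eta(x)\neq\mathcal{U}_\tau(x)\}$ where $\mathcal{U}_\tau(x)$ is the neighborhood filter of $x$. For a function $F:\mathbb{R}\to\mathbb{R}$, $\tau[F]$ is the topology on $\mathbb{R}$ in which $U\subset\mathbb{R}$ is open iff $U=\{x\in\mathbb{R} : (x,F(x))\in V\}$ for some open $V\subset\mathbb{R}^2$; equivalently, the unique topology making $x\mapsto(x,F(x))$ a homeomorphism onto the graph of $F$ with its subspace topology from $\mathbb{R}^2$. *)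

theory Defs
  imports "HOL-Analysis.Analysis"
begin

definition finer_topologies :: "real topology set" where
  "finer_topologies = {\<tau>. topspace \<tau> = UNIV \<and> (\<forall>U. open U \<longrightarrow> openin \<tau> U)}"

definition nbhd_filter :: "'a topology \<Rightarrow> 'a \<Rightarrow> 'a set set" where
  "nbhd_filter \<tau> x = {N. \<exists>U. openin \<tau> U \<and> x \<in> U \<and> U \<subseteq> N}"

definition Gamma :: "real topology \<Rightarrow> real set" where
  "Gamma \<tau> = {x. nbhd_filter euclidean x \<noteq> nbhd_filter \<tau> x}"

definition graph_topology :: "(real \<Rightarrow> real) \<Rightarrow> real topology" where
  "graph_topology F = topology (\<lambda>U. \<exists>V::(real \<times> real) set. open V \<and> U = {x. (x, F x) \<in> V})"

end

theory Submission
  imports Defs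
begin

text \<open>
  The components of a locally connected \<open>\<tau>\<close> finer than the Euclidean topology are \<open>\<tau>\<close>-open
  intervals, possibly degenerate. If a point \<open>x\<close> of a component \<open>C\<close> had a small connected
  neighbourhood missing all points to its right, then \<open>C\<close> could be cut at \<open>x\<close>, so \<open>\<tau>\<close> induces
  the Euclidean topology on \<open>C\<close>. Hence \<open>\<tau>\<close> is the disjoint sum of its components, each of which
  is a point or one of finitely many nondegenerate intervals up to homeomorphism, and only the
  number of components of each kind matters. Nondegenerate components are countable in number; the
  degenerate ones form the closed set \<open>\<Gamma>(\<tau>)\<close> up to a countable set, so there are countably many
  or continuum many of them. If \<open>\<tau>\<close> is separable then its components are countable in number, and
  the locally constant \<open>F\<close> which enumerates them satisfies \<open>\<tau> = \<tau>[F]\<close>.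
\<close>

section \<open>Gluing homeomorphisms over disjoint open covers\<close>

text \<open>The maps \<open>f i\<close> and their inverses \<open>g i\<close> are pasted separately.
  Disjointness makes the compatibility condition of pasting trivial, and the pasted maps are
  mutually inverse because \<open>f i\<close> and \<open>g i\<close> exchange \<open>A i\<close> and
  \<open>B i\<close>.\<close>

lemma homeomorphic_space_disjoint_open_cover:
  assumes X: "\<And>i. i \<in> I \<Longrightarrow> openin X (A i)" "topspace X = (\<Union>i\<in>I. A i)" "disjoint_family_on A I"
    and Y: "\<And>i. i \<in> I \<Longrightarrow> openin Y (B i)" "topspace Y = (\<Union>i\<in>I. B i)" "disjoint_family_on B I"
    and hom: "\<And>i. i \<in> I \<Longrightarrow> subtopology X (A i) homeomorphic_space subtopology Y (B i)"
  shows "X homeomorphic_space Y"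
proof -
  obtain f g where fg: "\<And>i. i \<in> I \<Longrightarrow>
      homeomorphic_maps (subtopology X (A i)) (subtopology Y (B i)) (f i) (g i)"
    using hom unfolding homeomorphic_space_def by metis
  have A: "A i \<subseteq> topspace X" if "i \<in> I" for i
    by (simp add: X(1) openin_subset that)
  have B: "B i \<subseteq> topspace Y" if "i \<in> I" for i
    by (simp add: Y(1) openin_subset that)
  have fB: "f i x \<in> B i" "g i (f i x) = x" if "i \<in> I" "x \<in> A i" for i x
    using fg[OF that(1)] that(2) A[OF that(1)]
    by (auto simp: homeomorphic_maps_def continuous_map_in_subtopology Int_absorb1 Pi_iff)
  have gA: "g i y \<in> A i" "f i (g i y) = y" if "i \<in> I" "y \<in> B i" for i y
    using fg[OF that(1)] that(2) B[OF that(1)]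
    by (auto simp: homeomorphic_maps_def continuous_map_in_subtopology Int_absorb1 Pi_iff)
  obtain F where F: "continuous_map X Y F" "\<And>x i. \<lbrakk>i \<in> I; x \<in> topspace X \<inter> A i\<rbrakk> \<Longrightarrow> F x = f i x"
  proof (rule pasting_lemma_exists[where X=X and I=I and T=A and Y=Y and f=f])
    show "continuous_map (subtopology X (A i)) Y (f i)" if "i \<in> I" for i
      using fg[OF that] by (simp add: homeomorphic_maps_def continuous_map_in_subtopology)
    show "f i x = f j x" if "i \<in> I" "j \<in> I" "x \<in> topspace X \<inter> A i \<inter> A j" for i j x
      using disjoint_family_onD[OF X(3) that(1,2)] that(3) by (cases "i = j") auto
    show "topspace X \<subseteq> (\<Union>i\<in>I. A i)" using X(2) by simp
    show "openin X (A i)" if "i \<in> I" for i using that by (rule X(1))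
  qed (rule that)
  obtain G where G: "continuous_map Y X G" "\<And>y i. \<lbrakk>i \<in> I; y \<in> topspace Y \<inter> B i\<rbrakk> \<Longrightarrow> G y = g i y"
  proof (rule pasting_lemma_exists[where X=Y and I=I and T=B and Y=X and f=g])
    show "continuous_map (subtopology Y (B i)) X (g i)" if "i \<in> I" for i
      using fg[OF that] by (simp add: homeomorphic_maps_def continuous_map_in_subtopology)
    show "g i x = g j x" if "i \<in> I" "j \<in> I" "x \<in> topspace Y \<inter> B i \<inter> B j" for i j x
      using disjoint_family_onD[OF Y(3) that(1,2)] that(3) by (cases "i = j") auto
    show "topspace Y \<subseteq> (\<Union>i\<in>I. B i)" using Y(2) by simp
    show "openin Y (B i)" if "i \<in> I" for i using that by (rule Y(1))
  qed (rule that)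
  have "G (F x) = x" if "x \<in> topspace X" for x
  proof -
    obtain i where i: "i \<in> I" "x \<in> A i" using \<open>x \<in> topspace X\<close> X(2) by blast
    then have "F x = f i x" using F(2) that by simp
    moreover have "G (f i x) = g i (f i x)" using G(2) fB(1) B i by blast
    ultimately show ?thesis using fB(2) i by simp
  qed
  moreover have "F (G y) = y" if "y \<in> topspace Y" for y
  proof -
    obtain i where i: "i \<in> I" "y \<in> B i" using \<open>y \<in> topspace Y\<close> Y(2) by blast
    then have "G y = g i y" using G(2) that by simp
    moreover have "F (g i y) = f i (g i y)" using F(2) gA(1) A i by blast
    ultimately show ?thesis using gA(2) i by simp
  qed
  ultimately show ?thesis
    using F(1) G(1) unfolding homeomorphic_space_def homeomorphic_maps_def by blast
qed

section \<open>Cardinalities of closed sets and codes for them\<close>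

text \<open>The Cantor-Bendixson argument. It settles the possible sizes of the closed set
  \<open>Gamma \<tau>\<close> without the continuum hypothesis.\<close>

lemma uncountable_closed_lepoll:
  fixes S :: "'a::{second_countable_topology,complete_space} set"
  assumes "closed S" "uncountable S"
  shows "(UNIV::real set) \<lesssim> S"
proof -
  text \<open>The condensation points of \<open>S\<close> form a perfect set.\<close>
  define P where "P = {x. \<forall>U. open U \<longrightarrow> x \<in> U \<longrightarrow> uncountable (U \<inter> S)}"
  obtain B :: "'a set set" where B: "countable B" "\<And>b. b \<in> B \<Longrightarrow> open b"
    "\<And>U. open U \<Longrightarrow> \<exists>V. V \<subseteq> B \<and> U = \<Union>V"
    using univ_second_countable by blast
  \<comment> \<open>A point that is not a condensation point has a basic neighbourhood meeting
    \<open>S\<close> in a countable set, and there are only countably many basic sets.\<close>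
  have "S - P \<subseteq> (\<Union>b\<in>{b\<in>B. countable (b \<inter> S)}. b \<inter> S)"
  proof
    fix x assume x: "x \<in> S - P"
    then obtain U where U: "open U" "x \<in> U" "countable (U \<inter> S)"
      by (auto simp: P_def)
    obtain V where "V \<subseteq> B" "U = \<Union>V" using B(3)[OF U(1)] by blast
    then obtain b where "b \<in> B" "x \<in> b" "b \<subseteq> U" using U(2) by blast
    moreover from this have "countable (b \<inter> S)"
      using U(3) by (meson Int_mono countable_subset order_refl)
    ultimately show "x \<in> (\<Union>b\<in>{b\<in>B. countable (b \<inter> S)}. b \<inter> S)" using x by blast
  qed
  moreover have "countable (\<Union>b\<in>{b\<in>B. countable (b \<inter> S)}. b \<inter> S)"
    using B(1) by (intro countable_UN) auto
  ultimately have SP: "countable (S - P)" using countable_subset by blast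
  have PS: "P \<subseteq> S"
  proof
    fix x assume "x \<in> P"
    then have "\<forall>U. open U \<longrightarrow> x \<in> U \<longrightarrow> uncountable (U \<inter> S)" by (simp add: P_def)
    from this[rule_format, OF open_Compl[OF \<open>closed S\<close>]]
    show "x \<in> S" by auto
  qed
  \<comment> \<open>No point of \<open>P\<close> is isolated: otherwise a neighbourhood of it would
    meet \<open>S\<close> only in that point and in the countable set \<open>S - P\<close>.\<close>
  have limit: "\<exists>y\<noteq>x. y \<in> P \<and> y \<in> U" if "x \<in> P" "open U" "x \<in> U" for x U
  proof (rule ccontr)
    assume "\<not> ?thesis"
    then have "U \<inter> S \<subseteq> insert x (S - P)" by blast
    then have "countable (U \<inter> S)" using SP by (meson countable_insert countable_subset)
    then show False using that by (simp add: P_def)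
  qed
  have closed: "x \<in> P" if x: "\<And>U. x \<in> U \<Longrightarrow> open U \<Longrightarrow> \<exists>y\<in>P. y \<in> U" for x
    unfolding P_def
  proof (intro CollectI allI impI)
    fix U assume "open U" "x \<in> U"
    then obtain y where "y \<in> P" "y \<in> U" using x by blast
    then show "uncountable (U \<inter> S)" using \<open>open U\<close> by (simp add: P_def)
  qed
  have "euclidean derived_set_of P = P"
  proof (intro subset_antisym subsetI)
    fix x assume "x \<in> euclidean derived_set_of P"
    then have "\<exists>y\<in>P. y \<in> U" if "x \<in> U" "open U" for U
      using that unfolding in_derived_set_of open_openin[symmetric] by metis
    then show "x \<in> P" by (rule closed)
  next
    fix x assume "x \<in> P"
    then show "x \<in> euclidean derived_set_of P"
      using limit by (simp add: in_derived_set_of)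
  qed
  moreover have "P \<noteq> {}"
    using SP assms(2) by auto
  ultimately have "(UNIV::real set) \<lesssim> P"
    using lepoll_perfect_set completely_metrizable_space_euclidean by blast
  then show ?thesis
    using PS by (meson lepoll_trans subset_imp_lepoll)
qed

text \<open>The countable \<open>D\<close> embeds into the infinite set \<open>S - D\<close>, so
  putting \<open>D\<close> back does not enlarge the cardinality of \<open>S - D\<close>.\<close>

lemma lepoll_minus_countable:
  includes cardinal_syntax
  assumes "A \<lesssim> S" "countable D" "uncountable (S - D)"
  shows "A \<lesssim> S - D"
proof -
  have inf: "infinite (S - D)" using assms(3) countable_finite by blast
  have "D \<lesssim> (UNIV::nat set)" using assms(2) unfolding lepoll_def countable_def by blast
  also have "\<dots> \<lesssim> S - D" using inf infinite_le_lepoll by blast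
  finally have "|D| \<le>o |S - D|" by (simp add: lepoll_def card_of_ordLeq)
  then have "|(S - D) \<union> D| \<le>o |S - D|"
    using inf by (intro card_of_Un_ordLeq_infinite_Field) (auto simp: Field_card_of card_of_card_order_on card_of_mono1)
  then have "(S - D) \<union> D \<lesssim> S - D" by (simp add: lepoll_def card_of_ordLeq)
  moreover have "S \<lesssim> (S - D) \<union> D" by (rule subset_imp_lepoll) blast
  ultimately show ?thesis using assms(1) lepoll_trans by blast
qed

text \<open>On \<open>A\<close> the function \<open>f\<close> factors through \<open>g\<close>, by
  choosing a preimage of each value. This later bounds the number of homeomorphism classes by the
  number of codes.\<close>

lemma countable_image_factor:
  assumes "countable (g ` A)" "\<And>x y. x \<in> A \<Longrightarrow> y \<in> A \<Longrightarrow> g x = g y \<Longrightarrow> f x = f y"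
  shows "countable (f ` A)"
proof -
  have "f ` A \<subseteq> (\<lambda>c. f (SOME x. x \<in> A \<and> g x = c)) ` g ` A"
  proof
    fix z assume "z \<in> f ` A"
    then obtain x where x: "x \<in> A" "z = f x" by blast
    have "(SOME y. y \<in> A \<and> g y = g x) \<in> A \<and> g (SOME y. y \<in> A \<and> g y = g x) = g x"
      by (rule someI_ex) (use x in blast)
    then have "z = f (SOME y. y \<in> A \<and> g y = g x)" using assms(2) x by metis
    then show "z \<in> (\<lambda>c. f (SOME x. x \<in> A \<and> g x = c)) ` g ` A" using x by blast
  qed
  then show ?thesis using assms(1) by (meson countable_image countable_subset)
qed

text \<open>The value type is countable, which makes the final count possible. A single value for
  all uncountable sets suffices, since the only uncountable cardinality that will occur is that of
  the continuum.\<close>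

definition card_code :: "'a set \<Rightarrow> nat option option" where
  "card_code A = (if finite A then Some (Some (card A)) else if countable A then Some None else None)"

lemma card_code_eqpoll:
  assumes A: "countable A \<or> A \<approx> (UNIV::real set)" and B: "countable B \<or> B \<approx> (UNIV::real set)"
    and eq: "card_code A = card_code B"
  shows "A \<approx> B"
proof (cases "finite A")
  case True
  then show ?thesis using eq by (auto simp: card_code_def eqpoll_iff_card split: if_splits)
next
  case False
  then have inf: "infinite B" using eq by (auto simp: card_code_def split: if_splits)
  show ?thesis
  proof (cases "countable A")
    case True
    then have "countable B" using eq False inf by (auto simp: card_code_def split: if_splits)
    then have "A \<approx> (UNIV::nat set)" "B \<approx> (UNIV::nat set)"
      using True False inf to_nat_on_infinite unfolding eqpoll_def by blast+
    then show ?thesis by (meson eqpoll_sym eqpoll_trans)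
  next
    case False
    then have "uncountable B"
      using eq \<open>infinite A\<close> inf by (auto simp: card_code_def split: if_splits)
    then show ?thesis using False A B by (meson eqpoll_sym eqpoll_trans)
  qed
qed

section \<open>Intervals of the line up to homeomorphism\<close>

text \<open>These are the four intervals with endpoints 0 and 1, one for each choice of endpoints to
  include.\<close>

definition unit_intervals :: "real set set" where
  "unit_intervals = {Q. {0<..<1} \<subseteq> Q \<and> Q \<subseteq> {0..1}}"

lemma finite_unit_intervals: "finite unit_intervals"
proof -
  have "Q \<in> (\<lambda>A. {0<..<1} \<union> A) ` Pow {0,1}" if "Q \<in> unit_intervals" for Q
  proof
    show "Q = {0<..<1} \<union> (Q \<inter> {0,1})"
    proof (intro subset_antisym subsetI)
      fix x assume "x \<in> Q"
      moreover from this have "0 \<le> x" "x \<le> 1" using that unfolding unit_intervals_def by auto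
      ultimately show "x \<in> {0<..<1} \<union> (Q \<inter> {0,1})" by force
    qed (use that in \<open>auto simp: unit_intervals_def\<close>)
  qed auto
  then have "unit_intervals \<subseteq> (\<lambda>A. {0<..<1} \<union> A) ` Pow {0,1}" by blast
  then show ?thesis by (rule finite_subset) simp
qed

text \<open>The map \<open>arctan\<close> makes \<open>P\<close> bounded, and an affine map then
  moves the infimum and the supremum of the image to 0 and 1.\<close>

lemma homeomorphic_unit_interval:
  fixes P :: "real set"
  assumes P: "connected P" and ab: "a \<in> P" "b \<in> P" "a < b"
  shows "\<exists>Q\<in>unit_intervals. top_of_set P homeomorphic_space top_of_set Q"
proof -
  define lo where "lo = Inf (arctan ` P)"
  define hi where "hi = Sup (arctan ` P)"
  have bdd: "bdd_below (arctan ` P)" "bdd_above (arctan ` P)"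
    using arctan_lbound arctan_ubound
    by (auto intro!: bdd_belowI[of _ "- (pi/2)"] bdd_aboveI[of _ "pi/2"] intro: less_imp_le)
  have bounds: "lo \<le> arctan x" "arctan x \<le> hi" if "x \<in> P" for x
    using that bdd unfolding lo_def hi_def by (auto intro: cInf_lower cSup_upper)
  have "arctan a < arctan b" using ab by (simp add: arctan_less_iff)
  then have lohi: "lo < hi" using bounds ab by (meson le_less_trans less_le_trans)
  define k where "k x = (arctan x - lo) / (hi - lo)" for x
  define l where "l y = tan (lo + (hi - lo) * y)" for y
  have affine: "lo + (hi - lo) * k x = arctan x" for x
    using lohi by (simp add: k_def)
  then have lk: "l (k x) = x" for x
    by (simp add: l_def tan_arctan)
  have cont: "continuous_on P k"
    unfolding k_def using lohi by (intro continuous_intros) auto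
  have "continuous_on (k ` P) l"
    unfolding l_def using cos_arctan_not_zero
    by (intro continuous_intros) (auto simp: affine)
  then have "homeomorphic_maps (top_of_set P) (top_of_set (k ` P)) k l"
    using cont by (auto simp: homeomorphic_maps_def lk)
  moreover have "k ` P \<in> unit_intervals"
    unfolding unit_intervals_def
  proof (intro CollectI conjI subsetI)
    fix y assume "y \<in> k ` P"
    then show "y \<in> {0..1}"
      using bounds lohi by (auto simp: k_def field_simps)
  next
    fix y :: real assume y: "y \<in> {0<..<1}"
    define z where "z = lo + (hi - lo) * y"
    have "lo < z" using y lohi by (simp add: z_def)
    moreover have "z < hi"
    proof -
      have "(hi - lo) * y < (hi - lo) * 1" using y lohi by (intro mult_strict_left_mono) auto
      then show ?thesis by (simp add: z_def)
    qed
    \<comment> \<open>Strictly between infimum and supremum, \<open>z\<close> lies between two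
      values of \<open>arctan\<close> on \<open>P\<close>, so connectedness of the image captures
      it.\<close>
    ultimately obtain u v where "u \<in> arctan ` P" "u < z" "v \<in> arctan ` P" "z < v"
      using cInf_less_iff[of "arctan ` P" z] less_cSup_iff[of "arctan ` P" z] bdd ab
      unfolding lo_def hi_def by blast
    moreover have "connected (arctan ` P)"
      using P by (intro connected_continuous_image continuous_intros)
    ultimately have "z \<in> arctan ` P"
      using connected_contains_Icc[of "arctan ` P" u v] by fastforce
    then obtain x where "x \<in> P" "z = arctan x" by blast
    moreover from this have "k x = y" using lohi by (simp add: k_def z_def flip: \<open>z = arctan x\<close>)
    ultimately show "y \<in> k ` P" by blast
  qed
  ultimately show ?thesis unfolding homeomorphic_space_def by blast
qed

text \<open>Meaningful for nonempty connected sets; on other sets the choice may be arbitrary. Since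
  equal forms only have to imply homeomorphism, it is immaterial which of the two homeomorphic
  half-open unit intervals is chosen.\<close>

definition normal_form :: "real set \<Rightarrow> real set" where
  "normal_form P = (if is_singleton P then {0} else
     (SOME Q. Q \<in> unit_intervals \<and> top_of_set P homeomorphic_space top_of_set Q))"

lemma normal_form:
  assumes "connected P" "P \<noteq> {}"
  shows "top_of_set P homeomorphic_space top_of_set (normal_form P)"
    and "\<not> is_singleton P \<Longrightarrow> normal_form P \<in> unit_intervals"
proof -
  have *: "normal_form P \<in> unit_intervals \<and> top_of_set P homeomorphic_space top_of_set (normal_form P)"
    if nsing: "\<not> is_singleton P"
  proof -
    obtain a b where "a \<in> P" "b \<in> P" "a < b"
      using assms(2) nsing by (metis is_singletonI' linorder_neqE)
    then have "\<exists>Q. Q \<in> unit_intervals \<and> top_of_set P homeomorphic_space top_of_set Q"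
      using homeomorphic_unit_interval[OF assms(1)] by blast
    then show ?thesis
      using nsing someI_ex[of "\<lambda>Q. Q \<in> unit_intervals \<and> top_of_set P homeomorphic_space top_of_set Q"]
      unfolding normal_form_def by simp
  qed
  then show "\<not> is_singleton P \<Longrightarrow> normal_form P \<in> unit_intervals" by blast
  show "top_of_set P homeomorphic_space top_of_set (normal_form P)"
  proof (cases "is_singleton P")
    case True
    then obtain x where "P = {x}" by (auto simp: is_singleton_def)
    then have "homeomorphic_maps (top_of_set P) (top_of_set (normal_form P)) (\<lambda>_. 0) (\<lambda>_. x)"
      using True by (auto simp: homeomorphic_maps_def normal_form_def)
    then show ?thesis unfolding homeomorphic_space_def by blast
  qed (use * in blast)
qed

text \<open>A point of \<open>C\<close> that is neither its least nor its greatest element lies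
  strictly between two points of \<open>C\<close>, hence in the interior.\<close>

lemma finite_connected_minus_interior:
  fixes C :: "real set"
  assumes "connected C"
  shows "finite (C - interior C)"
proof -
  define L where "L = {x\<in>C. \<forall>y\<in>C. x \<le> y}"
  define R where "R = {x\<in>C. \<forall>y\<in>C. y \<le> x}"
  have "x \<in> interior C" if x: "x \<in> C" "x \<notin> L" "x \<notin> R" for x
  proof -
    obtain a b where ab: "a \<in> C" "a < x" "b \<in> C" "x < b"
      using x unfolding L_def R_def by force
    then have "{a<..<b} \<subseteq> C"
      using connected_contains_Icc[OF assms] by fastforce
    then show ?thesis using ab by (intro interiorI[of "{a<..<b}"]) simp_all
  qed
  then have "C - interior C \<subseteq> L \<union> R" by blast
  moreover have "x = y" if "x \<in> L" "y \<in> L" for x y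
    using that unfolding L_def by force
  \<comment> \<open>The choice also covers an empty \<open>L\<close>, where the inclusion is
    vacuous.\<close>
  then have "L \<subseteq> {SOME x. x \<in> L}"
    by (metis singletonI someI subsetI)
  then have "finite L" by (rule finite_subset) simp
  moreover have "x = y" if "x \<in> R" "y \<in> R" for x y
    using that unfolding R_def by force
  then have "R \<subseteq> {SOME x. x \<in> R}"
    by (metis singletonI someI subsetI)
  then have "finite R" by (rule finite_subset) simp
  ultimately show ?thesis using finite_subset[of "C - interior C" "L \<union> R"] by simp
qed

section \<open>The graph topology\<close>

lemma openin_graph_topology:
  "openin (graph_topology F) U \<longleftrightarrow> (\<exists>V. open V \<and> U = {x. (x, F x) \<in> V})"
proof -
  have "istopology (\<lambda>U. \<exists>V::(real \<times> real) set. open V \<and> U = {x. (x, F x) \<in> V})"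
    unfolding istopology_def
  proof (intro conjI allI impI)
    fix S T
    assume "\<exists>V::(real \<times> real) set. open V \<and> S = {x. (x, F x) \<in> V}"
      and "\<exists>V::(real \<times> real) set. open V \<and> T = {x. (x, F x) \<in> V}"
    then obtain V W :: "(real \<times> real) set"
      where "open V" "S = {x. (x, F x) \<in> V}" "open W" "T = {x. (x, F x) \<in> W}" by blast
    then show "\<exists>V. open V \<and> S \<inter> T = {x. (x, F x) \<in> V}"
      by (intro exI[of _ "V \<inter> W"]) auto
  next
    fix K
    assume "\<forall>S\<in>K. \<exists>V::(real \<times> real) set. open V \<and> S = {x. (x, F x) \<in> V}"
    then obtain V :: "real set \<Rightarrow> (real \<times> real) set"
      where "\<And>S. S \<in> K \<Longrightarrow> open (V S) \<and> S = {x. (x, F x) \<in> V S}" by metis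
    then show "\<exists>V. open V \<and> \<Union>K = {x. (x, F x) \<in> V}"
      by (intro exI[of _ "\<Union>S\<in>K. V S"]) blast
  qed
  then show ?thesis by (simp add: graph_topology_def)
qed

section \<open>Components of a locally connected refinement\<close>

locale locally_connected_refinement =
  fixes \<tau> :: "real topology"
  assumes finer: "\<tau> \<in> finer_topologies"
    and locally_connected: "locally_connected_space \<tau>"
begin

abbreviation comps :: "real set set" where "comps \<equiv> connected_components_of \<tau>"

lemma topspace [simp]: "topspace \<tau> = UNIV"
  using finer by (simp add: finer_topologies_def)

lemma openin_of_open: "open U \<Longrightarrow> openin \<tau> U"
  using finer by (simp add: finer_topologies_def)

text \<open>The identity from \<open>\<tau>\<close> to the Euclidean line is continuous. Hence
  components, and connected neighbourhoods in them, are intervals.\<close>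

lemma connected_of_connectedin:
  assumes "connectedin \<tau> C"
  shows "connected C"
proof -
  have "continuous_map \<tau> euclidean id"
    unfolding continuous_map by (auto simp: openin_of_open)
  from connectedin_continuous_map_image[OF this assms] show ?thesis by simp
qed

lemma openin_comp: "C \<in> comps \<Longrightarrow> openin \<tau> C"
  using locally_connected openin_connected_components_of_locally_connected_space by blast

lemma connectedin_comp: "C \<in> comps \<Longrightarrow> connectedin \<tau> C"
  by (simp add: connectedin_connected_components_of)

lemma connected_comp: "C \<in> comps \<Longrightarrow> connected C"
  by (simp add: connectedin_comp connected_of_connectedin)

lemma nonempty_comp: "C \<in> comps \<Longrightarrow> C \<noteq> {}"
  by (simp add: nonempty_connected_components_of)

lemma Union_comps: "\<Union>comps = UNIV"
  by (simp add: Union_connected_components_of)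

lemma comps_eq: "C \<in> comps \<Longrightarrow> D \<in> comps \<Longrightarrow> x \<in> C \<Longrightarrow> x \<in> D \<Longrightarrow> C = D"
  using connected_components_of_overlap by blast

text \<open>If the interval \<open>D\<close> has a point to the right of \<open>x\<close>, it
  contains everything in between. If not, \<open>x\<close> is the last point of \<open>C\<close>,
  and any \<open>e\<close> beyond \<open>x\<close> works.\<close>

lemma right_nbhd_in_open:
  assumes "C \<in> comps" "x \<in> C" "openin \<tau> D" "connectedin \<tau> D" "x \<in> D"
  shows "\<exists>e>x. {x..<e} \<inter> C \<subseteq> D"
proof (cases "\<exists>d\<in>D. x < d")
  case True
  then obtain d where d: "d \<in> D" "x < d" by blast
  then have "{x..<d} \<subseteq> D"
    using connected_contains_Icc[OF connected_of_connectedin[OF assms(4)]] assms(5) by fastforce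
  then show ?thesis using d by blast
next
  case False
  text \<open>Here \<open>D \<union> {..<x}\<close> and \<open>{x<..}\<close> would separate \<open>C\<close> if the latter met \<open>C\<close>.\<close>
  have "openin \<tau> (D \<union> {..<x})" "openin \<tau> {x<..}"
    using assms(3) by (simp_all add: openin_Un openin_of_open)
  moreover have "y \<in> (D \<union> {..<x}) \<union> {x<..}" for y
    using assms(5) by (cases y x rule: linorder_cases) auto
  then have "C \<subseteq> (D \<union> {..<x}) \<union> {x<..}" by blast
  moreover have "(D \<union> {..<x}) \<inter> {x<..} \<inter> C = {}" using False by auto
  moreover have "(D \<union> {..<x}) \<inter> C \<noteq> {}" using assms(2,5) by blast
  ultimately have "{x<..} \<inter> C = {}"
    using connectedin_comp[OF assms(1)] unfolding connectedin by blast
  then have "{x..<x+1} \<inter> C \<subseteq> D"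
    using assms(5) by (auto simp: less_le)
  then show ?thesis by (intro exI[of _ "x+1"]) auto
qed

text \<open>The mirror image of \<open>right_nbhd_in_open\<close>.\<close>

lemma left_nbhd_in_open:
  assumes "C \<in> comps" "x \<in> C" "openin \<tau> D" "connectedin \<tau> D" "x \<in> D"
  shows "\<exists>e<x. {e<..x} \<inter> C \<subseteq> D"
proof (cases "\<exists>d\<in>D. d < x")
  case True
  then obtain d where d: "d \<in> D" "d < x" by blast
  then have "{d<..x} \<subseteq> D"
    using connected_contains_Icc[OF connected_of_connectedin[OF assms(4)]] assms(5) by fastforce
  then show ?thesis using d by blast
next
  case False
  have "openin \<tau> (D \<union> {x<..})" "openin \<tau> {..<x}"
    using assms(3) by (simp_all add: openin_Un openin_of_open)
  moreover have "y \<in> (D \<union> {x<..}) \<union> {..<x}" for y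
    using assms(5) by (cases y x rule: linorder_cases) auto
  then have "C \<subseteq> (D \<union> {x<..}) \<union> {..<x}" by blast
  moreover have "(D \<union> {x<..}) \<inter> {..<x} \<inter> C = {}" using False by auto
  moreover have "(D \<union> {x<..}) \<inter> C \<noteq> {}" using assms(2,5) by blast
  ultimately have "{..<x} \<inter> C = {}"
    using connectedin_comp[OF assms(1)] unfolding connectedin by blast
  then have "{x-1<..x} \<inter> C \<subseteq> D"
    using assms(5) by (auto simp: less_le)
  then show ?thesis by (intro exI[of _ "x-1"]) auto
qed

text \<open>Local connectedness places a connected open \<open>D\<close> around \<open>x\<close>
  inside \<open>S\<close>, and the two one-sided lemmas place a Euclidean neighbourhood of
  \<open>x\<close> relative to \<open>C\<close> inside \<open>D\<close>.\<close>

lemma subtopology_comp: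
  assumes C: "C \<in> comps"
  shows "subtopology \<tau> C = top_of_set C"
  unfolding topology_eq
proof (intro allI iffI)
  fix S assume "openin (top_of_set C) S"
  then show "openin (subtopology \<tau> C) S"
    using openin_of_open by (auto simp: openin_subtopology)
next
  fix S assume "openin (subtopology \<tau> C) S"
  then have S: "openin \<tau> S" "S \<subseteq> C"
    using openin_comp[OF C] by (auto simp: openin_open_subtopology)
  have "\<exists>T. openin (top_of_set C) T \<and> x \<in> T \<and> T \<subseteq> S" if x: "x \<in> S" for x
  proof -
    obtain D where D: "openin \<tau> D" "connectedin \<tau> D" "x \<in> D" "D \<subseteq> S"
      using locally_connected S(1) x unfolding locally_connected_space by blast
    obtain e d where "e > x" "{x..<e} \<inter> C \<subseteq> D" "d < x" "{d<..x} \<inter> C \<subseteq> D"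
      using right_nbhd_in_open[OF C _ D(1-3)] left_nbhd_in_open[OF C _ D(1-3)] S(2) x by blast
    moreover from this have "C \<inter> {d<..<e} \<subseteq> D"
      by (auto simp: subset_iff) (metis linorder_le_cases)
    ultimately show ?thesis
      using D(4) S(2) x by (intro exI[of _ "C \<inter> {d<..<e}"]) (auto intro: openin_open_Int)
  qed
  then show "openin (top_of_set C) S"
    by (subst openin_subopen) blast
qed

lemma openin_Int_comp:
  assumes "C \<in> comps" "openin \<tau> U"
  shows "\<exists>W. open W \<and> U \<inter> C = W \<inter> C"
proof -
  have "openin (top_of_set C) (U \<inter> C)"
    using assms by (metis openin_subtopology_Int subtopology_comp)
  then show ?thesis by (auto simp: openin_subtopology)
qed

section \<open>The set \<open>Gamma \<tau>\<close> and the number of components\<close>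

text \<open>The component of \<open>x\<close> is a \<open>\<tau>\<close>-neighbourhood of
  \<open>x\<close>, so equal filters force \<open>x\<close> into its Euclidean interior. Conversely,
  on the interior of a component both topologies agree.\<close>

lemma Gamma_eq: "Gamma \<tau> = - (\<Union>C\<in>comps. interior C)"
proof -
  have "nbhd_filter euclidean x = nbhd_filter \<tau> x \<longleftrightarrow> (\<exists>C\<in>comps. x \<in> interior C)" for x
  proof
    assume eq: "nbhd_filter euclidean x = nbhd_filter \<tau> x"
    obtain C where C: "C \<in> comps" "x \<in> C" using Union_comps by blast
    then have "C \<in> nbhd_filter \<tau> x" using openin_comp unfolding nbhd_filter_def by blast
    then have "C \<in> nbhd_filter euclidean x" using eq by simp
    then have "x \<in> interior C" unfolding nbhd_filter_def by (auto simp: interior_def)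
    then show "\<exists>C\<in>comps. x \<in> interior C" using C by blast
  next
    assume "\<exists>C\<in>comps. x \<in> interior C"
    then obtain C where C: "C \<in> comps" "x \<in> interior C" by blast
    have "N \<in> nbhd_filter euclidean x" if N: "N \<in> nbhd_filter \<tau> x" for N
    proof -
      obtain U where U: "openin \<tau> U" "x \<in> U" "U \<subseteq> N" using N unfolding nbhd_filter_def by blast
      obtain W where W: "open W" "U \<inter> C = W \<inter> C" using openin_Int_comp[OF C(1) U(1)] by blast
      then have "open (W \<inter> interior C)" "x \<in> W \<inter> interior C" "W \<inter> interior C \<subseteq> N"
        using U C interior_subset by blast+
      then show ?thesis unfolding nbhd_filter_def by auto
    qed
    moreover have "nbhd_filter euclidean x \<subseteq> nbhd_filter \<tau> x"
      unfolding nbhd_filter_def using openin_of_open by auto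
    ultimately show "nbhd_filter euclidean x = nbhd_filter \<tau> x" by blast
  qed
  then show ?thesis unfolding Gamma_def by blast
qed

lemma closed_Gamma: "closed (Gamma \<tau>)"
  unfolding Gamma_eq by (auto intro: open_UN)

lemma Gamma_subset: "Gamma \<tau> \<subseteq> (\<Union>C\<in>comps. C - interior C)"
  unfolding Gamma_eq using Union_comps by blast

text \<open>A component with empty interior is finite, and a finite connected set has at most one
  point. So the nondegenerate components are disjoint sets with nonempty interior.\<close>

lemma countable_nondegenerate_comps: "countable {C \<in> comps. \<not> is_singleton C}"
proof (rule countable_disjoint_nonempty_interior_subsets)
  show "pairwise disjnt {C \<in> comps. \<not> is_singleton C}"
    using pairwise_disjoint_connected_components_of by (rule pairwise_subset) auto
  fix C assume C: "C \<in> {C \<in> comps. \<not> is_singleton C}" and "interior C = {}"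
  then have "finite C" using finite_connected_minus_interior[of C] connected_comp by auto
  then show "C = {}"
    using C connected_comp connected_finite_iff_sing is_singleton_def by blast
qed

text \<open>The points \<open>I\<close> forming components by themselves are exactly those of the
  closed set \<open>Gamma \<tau>\<close> outside \<open>D\<close>, the countable set of endpoints
  that belong to nondegenerate components. Removing \<open>D\<close> preserves the dichotomy for
  closed sets.\<close>

lemma singleton_comps_cardinality:
  "countable {C \<in> comps. is_singleton C} \<or> {C \<in> comps. is_singleton C} \<approx> (UNIV::real set)"
proof -
  define I where "I = {x. {x} \<in> comps}"
  define D where "D = (\<Union>C\<in>{C \<in> comps. \<not> is_singleton C}. C - interior C)"
  have S: "{C \<in> comps. is_singleton C} = (\<lambda>x. {x}) ` I"
    by (auto simp: I_def is_singleton_def)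
  then have eq: "{C \<in> comps. is_singleton C} \<approx> I"
    by (simp add: inj_on_image_eqpoll_self)
  have D: "countable D"
    unfolding D_def
    by (intro countable_UN countable_nondegenerate_comps countable_finite
        finite_connected_minus_interior connected_comp) auto
  have "x \<in> Gamma \<tau>" if "x \<in> I" for x
  proof -
    have "x \<notin> interior C" if "C \<in> comps" for C
    proof
      assume "x \<in> interior C"
      then have "x \<in> C" using interior_subset by blast
      then have "C = {x}" using comps_eq[OF that, of "{x}" x] \<open>x \<in> I\<close> by (simp add: I_def)
      then show False using \<open>x \<in> interior C\<close> by simp
    qed
    then show ?thesis unfolding Gamma_eq by blast
  qed
  moreover have "I \<inter> D = {}"
    using comps_eq unfolding I_def D_def is_singleton_def by blast
  moreover have "Gamma \<tau> \<subseteq> I \<union> D"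
  proof
    fix x assume "x \<in> Gamma \<tau>"
    then obtain C where C: "C \<in> comps" "x \<in> C" "x \<notin> interior C"
      using Gamma_subset by blast
    show "x \<in> I \<union> D"
    proof (cases "is_singleton C")
      case True
      then have "C = {x}" using C(2) by (auto simp: is_singleton_def)
      then show ?thesis using C(1) by (simp add: I_def)
    next
      case False
      then show ?thesis using C by (auto simp: D_def)
    qed
  qed
  ultimately have I: "I = Gamma \<tau> - D" by blast
  show ?thesis
  proof (cases "countable I")
    case True
    then show ?thesis using S by simp
  next
    case False
    then have "uncountable (Gamma \<tau>)" using I by auto
    then have "(UNIV::real set) \<lesssim> Gamma \<tau>" using closed_Gamma uncountable_closed_lepoll by blast
    then have "(UNIV::real set) \<lesssim> I" using lepoll_minus_countable D False I by blast
    then have "I \<approx> (UNIV::real set)" by (simp add: lepoll_antisym subset_imp_lepoll)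
    then show ?thesis using eq eqpoll_trans by blast
  qed
qed

text \<open>Since \<open>{0}\<close> is not a unit interval, exactly the degenerate components have
  this form. Every other form occurs only among the countably many nondegenerate ones.\<close>

lemma comps_of_form_cardinality:
  "countable {C \<in> comps. normal_form C = Q} \<or> {C \<in> comps. normal_form C = Q} \<approx> (UNIV::real set)"
proof (cases "Q = {0}")
  case True
  have "{0} \<notin> unit_intervals"
  proof
    assume "{0} \<in> unit_intervals"
    then have "{0<..<1} \<subseteq> {0::real}" by (simp add: unit_intervals_def)
    moreover have "(1/2::real) \<in> {0<..<1}" by simp
    ultimately show False by (metis singletonD subsetD zero_neq_one divide_eq_0_iff zero_neq_numeral)
  qed
  then have "normal_form C \<noteq> {0}" if "C \<in> comps" "\<not> is_singleton C" for C
    using normal_form(2)[OF connected_comp nonempty_comp, OF that(1) that] by metis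
  moreover have "normal_form C = {0}" if "is_singleton C" for C
    using that by (simp add: normal_form_def)
  ultimately have "{C \<in> comps. normal_form C = Q} = {C \<in> comps. is_singleton C}"
    using True by blast
  then show ?thesis using singleton_comps_cardinality by simp
next
  case False
  then have "\<not> is_singleton C" if "normal_form C = Q" for C
    using that by (auto simp: normal_form_def)
  then have "{C \<in> comps. normal_form C = Q} \<subseteq> {C \<in> comps. \<not> is_singleton C}" by blast
  then show ?thesis using countable_nondegenerate_comps countable_subset by blast
qed

section \<open>The separable case\<close>

text \<open>Every component is open and nonempty, so it is the component of some point of a
  countable dense set.\<close>

lemma countable_comps:
  assumes "separable_space \<tau>"
  shows "countable comps"
proof -
  obtain D where D: "countable D" "\<tau> closure_of D = UNIV"
    using assms unfolding separable_space_def by auto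
  have "C \<in> connected_component_of_set \<tau> ` D" if C: "C \<in> comps" for C
  proof -
    obtain y where y: "y \<in> C" using nonempty_comp[OF C] by blast
    have "y \<in> \<tau> closure_of D" by (simp add: D(2))
    then obtain x where "x \<in> D" "x \<in> C"
      using openin_comp[OF C] y unfolding in_closure_of by blast
    moreover have "connected_component_of_set \<tau> x \<in> comps" "x \<in> connected_component_of_set \<tau> x"
      by (auto simp: connected_components_of_def connected_component_of_refl)
    ultimately show ?thesis using comps_eq[OF C] by blast
  qed
  then have "comps \<subseteq> connected_component_of_set \<tau> ` D" by blast
  then show ?thesis by (rule countable_subset) (simp add: D(1))
qed

lemma countable_Gamma:
  assumes "separable_space \<tau>"
  shows "countable (Gamma \<tau>)"
proof (rule countable_subset[OF Gamma_subset countable_UN[OF countable_comps[OF assms]]])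
  fix C assume "C \<in> comps"
  then show "countable (C - interior C)"
    by (intro countable_finite finite_connected_minus_interior connected_comp)
qed

text \<open>Giving the components distinct integer heights separates them in the graph, while over
  each single component the graph is a horizontal copy with its Euclidean topology.\<close>

lemma eq_graph_topology:
  assumes "separable_space \<tau>"
  shows "\<exists>F. \<tau> = graph_topology F"
proof -
  obtain n :: "real set \<Rightarrow> nat" where n: "inj_on n comps"
    using countable_comps[OF assms] unfolding countable_def by blast
  define F where "F x = real (n (connected_component_of_set \<tau> x))" for x
  have F: "F x = real (n C)" if "C \<in> comps" "x \<in> C" for x C
  proof -
    have "connected_component_of_set \<tau> x \<in> comps" "x \<in> connected_component_of_set \<tau> x"
      by (auto simp: connected_components_of_def connected_component_of_refl)
    then have "connected_component_of_set \<tau> x = C" using comps_eq that by blast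
    then show ?thesis by (simp add: F_def)
  qed
  have "openin \<tau> U \<longleftrightarrow> (\<exists>V. open V \<and> U = {x. (x, F x) \<in> V})" for U
  proof
    assume "openin \<tau> U"
    then have "\<forall>C\<in>comps. \<exists>W. open W \<and> U \<inter> C = W \<inter> C"
      using openin_Int_comp by blast
    then obtain W where W: "\<forall>C\<in>comps. open (W C) \<and> U \<inter> C = W C \<inter> C"
      by (rule bchoice[THEN exE])
    \<comment> \<open>The strip of radius 1/2 about an integer height contains no other integer, so
      over \<open>C\<close> the set \<open>V\<close> meets the graph exactly in the part given by
      \<open>W C\<close>.\<close>
    define V where "V = (\<Union>C\<in>comps. W C \<times> {real (n C) - 1/2<..<real (n C) + 1/2})"
    have "open V" unfolding V_def using W by (intro open_UN ballI open_Times) auto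
    moreover have "x \<in> U \<longleftrightarrow> (x, F x) \<in> V" for x
    proof -
      obtain C where C: "C \<in> comps" "x \<in> C" using Union_comps by blast
      have "C' = C" if "C' \<in> comps" "F x \<in> {real (n C') - 1/2<..<real (n C') + 1/2}" for C'
      proof -
        have "n C' = n C" using that(2) F[OF C] by auto
        then show ?thesis using n that(1) C(1) by (simp add: inj_on_eq_iff)
      qed
      moreover have "F x \<in> {real (n C) - 1/2<..<real (n C) + 1/2}" using F[OF C] by simp
      ultimately have "(x, F x) \<in> V \<longleftrightarrow> x \<in> W C"
        unfolding V_def using C(1) by blast
      then show ?thesis using W C by blast
    qed
    ultimately show "\<exists>V. open V \<and> U = {x. (x, F x) \<in> V}" by blast
  next
    assume "\<exists>V. open V \<and> U = {x. (x, F x) \<in> V}"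
    then obtain V where V: "open V" "U = {x. (x, F x) \<in> V}" by blast
    \<comment> \<open>Over \<open>C\<close> the graph has the fixed height \<open>n C\<close>, so
      \<open>U\<close> is assembled from horizontal slices of \<open>V\<close>, which are Euclidean
      open, cut down to \<open>\<tau>\<close>-open components.\<close>
    have "x \<in> U \<longleftrightarrow> x \<in> (\<Union>C\<in>comps. C \<inter> {x. (x, real (n C)) \<in> V})" for x
    proof -
      obtain C where C: "C \<in> comps" "x \<in> C" using Union_comps by blast
      have "x \<in> (\<Union>C\<in>comps. C \<inter> {x. (x, real (n C)) \<in> V}) \<longleftrightarrow> (x, real (n C)) \<in> V"
        using comps_eq[OF C(1) _ C(2)] C by blast
      then show ?thesis using V(2) F[OF C] by simp
    qed
    then have "U = (\<Union>C\<in>comps. C \<inter> {x. (x, real (n C)) \<in> V})" by blast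
    moreover have "open {x. (x, real (n C)) \<in> V}" for C
      using open_vimage[OF V(1), of "\<lambda>x. (x, real (n C))"]
      by (simp add: vimage_def continuous_on_Pair)
    then have "openin \<tau> (C \<inter> {x. (x, real (n C)) \<in> V})" if "C \<in> comps" for C
      using that by (intro openin_Int openin_comp openin_of_open)
    then have "openin \<tau> (\<Union>C\<in>comps. C \<inter> {x. (x, real (n C)) \<in> V})"
      by (intro openin_Union) (elim imageE, simp)
    ultimately show "openin \<tau> U" by simp
  qed
  then have "\<tau> = graph_topology F" by (simp add: topology_eq openin_graph_topology)
  then show ?thesis by blast
qed

end

section \<open>Classification by the numbers of components of each form\<close>

text \<open>The restriction to a finite set of forms makes the code an extensional function from a
  finite set to a countable type; there are only countably many of these.\<close>

definition component_code :: "real topology \<Rightarrow> real set \<Rightarrow> nat option option" where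
  "component_code \<tau> = (\<lambda>Q\<in>insert {0} unit_intervals.
     card_code {C \<in> connected_components_of \<tau>. normal_form C = Q})"

text \<open>Equal codes give a bijection between the components of each form. Matched components are
  homeomorphic through their common form, and these homeomorphisms are glued.\<close>

lemma component_code_homeomorphic:
  assumes \<sigma>: "locally_connected_refinement \<sigma>" and \<tau>: "locally_connected_refinement \<tau>"
    and code: "component_code \<sigma> = component_code \<tau>"
  shows "\<sigma> homeomorphic_space \<tau>"
proof -
  interpret S: locally_connected_refinement \<sigma> by fact
  interpret T: locally_connected_refinement \<tau> by fact
  define CS where "CS Q = {C \<in> S.comps. normal_form C = Q}" for Q
  define CT where "CT Q = {C \<in> T.comps. normal_form C = Q}" for Q
  define N where "N = insert {0::real} unit_intervals"
  have N: "normal_form C \<in> N" if "C \<noteq> {}" "connected C" for C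
    using normal_form(2)[OF that(2,1)] unfolding N_def by (auto simp: normal_form_def)
  have "CS Q \<approx> CT Q" if "Q \<in> N" for Q
  proof (rule card_code_eqpoll)
    show "card_code (CS Q) = card_code (CT Q)"
      using fun_cong[OF code, of Q] that by (simp add: component_code_def CS_def CT_def N_def)
  qed (simp_all add: CS_def CT_def S.comps_of_form_cardinality T.comps_of_form_cardinality)
  then obtain b where b: "\<And>Q. Q \<in> N \<Longrightarrow> bij_betw (b Q) (CS Q) (CT Q)"
    unfolding eqpoll_def by metis
  \<comment> \<open>Each component is moved by the bijection belonging to its own form. As forms are
    preserved, the separate bijections fit together to one between all components.\<close>
  define \<phi> where "\<phi> C = b (normal_form C) C" for C
  have bS: "bij_betw (b (normal_form C)) (CS (normal_form C)) (CT (normal_form C))"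
    if "C \<in> S.comps" for C
    using that by (intro b N S.nonempty_comp S.connected_comp)
  have "\<phi> C \<in> CT (normal_form C)" if "C \<in> S.comps" for C
    unfolding \<phi>_def by (rule bij_betw_apply[OF bS[OF that]]) (simp add: CS_def that)
  then have \<phi>: "\<phi> C \<in> T.comps" "normal_form (\<phi> C) = normal_form C" if "C \<in> S.comps" for C
    using that by (simp_all add: CT_def)
  have inj: "C = D" if CD: "C \<in> S.comps" "D \<in> S.comps" "\<phi> C = \<phi> D" for C D
  proof -
    have nf: "normal_form C = normal_form D" using \<phi>(2)[OF CD(1)] \<phi>(2)[OF CD(2)] CD(3) by simp
    show ?thesis
    proof (rule inj_onD[OF bij_betw_imp_inj_on[OF bS[OF CD(1)]]])
      show "b (normal_form C) C = b (normal_form C) D" using CD(3) nf by (simp add: \<phi>_def)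
    qed (use CD nf in \<open>simp_all add: CS_def\<close>)
  qed
  have surj: "\<exists>C\<in>S.comps. \<phi> C = E" if E: "E \<in> T.comps" for E
  proof -
    have "bij_betw (b (normal_form E)) (CS (normal_form E)) (CT (normal_form E))"
      using E by (intro b N T.nonempty_comp T.connected_comp)
    moreover have "E \<in> CT (normal_form E)" using E by (simp add: CT_def)
    ultimately obtain C where "C \<in> CS (normal_form E)" "E = b (normal_form E) C"
      unfolding bij_betw_def by blast
    then show ?thesis by (intro bexI[of _ C]) (simp_all add: CS_def \<phi>_def)
  qed
  show ?thesis
  proof (rule homeomorphic_space_disjoint_open_cover[of S.comps \<sigma> "\<lambda>C. C" \<tau> \<phi>])
    show "topspace \<sigma> = (\<Union>C\<in>S.comps. C)" using S.Union_comps by simp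
    have "\<phi> ` S.comps = T.comps"
      using surj \<phi>(1) by (intro subset_antisym subsetI) force+
    then show "topspace \<tau> = (\<Union>C\<in>S.comps. \<phi> C)" using T.Union_comps by simp
    show "disjoint_family_on (\<lambda>C. C) S.comps"
      unfolding disjoint_family_on_def using S.comps_eq by blast
    show "disjoint_family_on \<phi> S.comps"
      unfolding disjoint_family_on_def
      using connected_components_of_overlap[OF \<phi>(1) \<phi>(1)] inj by metis
    fix C assume C: "C \<in> S.comps"
    show "openin \<sigma> C" "openin \<tau> (\<phi> C)"
      using C S.openin_comp T.openin_comp \<phi>(1) by auto
    \<comment> \<open>Both sides are homeomorphic to the same normal form, and
      \<open>subtopology_comp\<close> turns this into a statement about the subspaces of
      \<open>\<sigma>\<close> and \<open>\<tau>\<close>.\<close>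
    have "top_of_set C homeomorphic_space top_of_set (\<phi> C)"
      using homeomorphic_space_trans[OF normal_form(1)[OF S.connected_comp S.nonempty_comp, OF C C]
          normal_form(1)[OF T.connected_comp T.nonempty_comp, OF \<phi>(1) \<phi>(1), OF C C,
            unfolded \<phi>(2)[OF C], THEN homeomorphic_space_sym[THEN iffD1]]] .
    then show "subtopology \<sigma> C homeomorphic_space subtopology \<tau> (\<phi> C)"
      using C \<phi>(1) S.subtopology_comp T.subtopology_comp by simp
  qed
qed

theorem theorem4:
  shows "countable ({\<tau> \<in> finer_topologies. locally_connected_space \<tau>}
            // {(\<sigma>, \<tau>). \<sigma> homeomorphic_space \<tau>})
    \<and> (\<forall>\<tau>. \<tau> \<in> finer_topologies \<and> locally_connected_space \<tau> \<and> separable_space \<tau>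
          \<longrightarrow> (\<exists>F. \<tau> = graph_topology F) \<and> countable (Gamma \<tau>) \<and> closed (Gamma \<tau>))"
proof (intro conjI)
  define A where "A = {\<tau> \<in> finer_topologies. locally_connected_space \<tau>}"
  \<comment> \<open>The relation is not restricted to \<open>A\<close>: a class may contain
    homeomorphic topologies outside \<open>A\<close>, but the quotient counts only the classes of
    members of \<open>A\<close>.\<close>
  define r where "r = {(\<sigma>::real topology, \<tau>::real topology). \<sigma> homeomorphic_space \<tau>}"
  have A: "locally_connected_refinement \<tau>" if "\<tau> \<in> A" for \<tau>
    using that by (simp add: A_def locally_connected_refinement_def)
  have "countable (component_code ` A)"
  proof (rule countable_subset)
    show "component_code ` A \<subseteq> insert {0} unit_intervals \<rightarrow>\<^sub>E UNIV"
      by (intro image_subsetI) (simp add: component_code_def del: insert_iff)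
    show "countable (insert {0} unit_intervals \<rightarrow>\<^sub>E (UNIV :: nat option option set))"
      by (intro countable_PiE) (simp_all add: finite_unit_intervals)
  qed
  moreover have "r `` {\<sigma>} = r `` {\<tau>}"
    if "\<sigma> \<in> A" "\<tau> \<in> A" "component_code \<sigma> = component_code \<tau>" for \<sigma> \<tau>
  proof -
    have "\<sigma> homeomorphic_space \<tau>"
      using that by (intro component_code_homeomorphic A)
    moreover from this have "\<tau> homeomorphic_space \<sigma>"
      by (rule homeomorphic_space_sym[THEN iffD1])
    ultimately have "\<sigma> homeomorphic_space \<rho> \<longleftrightarrow> \<tau> homeomorphic_space \<rho>" for \<rho> :: "real topology"
      using homeomorphic_space_trans by blast
    then show ?thesis by (simp add: r_def)
  qed
  ultimately have "countable ((\<lambda>\<tau>. r `` {\<tau>}) ` A)"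
    by (rule countable_image_factor)
  moreover have "A // r = (\<lambda>\<tau>. r `` {\<tau>}) ` A"
    by (auto simp: quotient_def)
  ultimately show "countable ({\<tau> \<in> finer_topologies. locally_connected_space \<tau>}
            // {(\<sigma>, \<tau>). \<sigma> homeomorphic_space \<tau>})"
    unfolding A_def r_def by simp
next
  show "\<forall>\<tau>. \<tau> \<in> finer_topologies \<and> locally_connected_space \<tau> \<and> separable_space \<tau>
          \<longrightarrow> (\<exists>F. \<tau> = graph_topology F) \<and> countable (Gamma \<tau>) \<and> closed (Gamma \<tau>)"
  proof (intro allI impI)
    fix \<tau>
    assume \<tau>: "\<tau> \<in> finer_topologies \<and> locally_connected_space \<tau> \<and> separable_space \<tau>"
    then interpret locally_connected_refinement \<tau> by unfold_locales simp_all
    show "(\<exists>F. \<tau> = graph_topology F) \<and> countable (Gamma \<tau>) \<and> closed (Gamma \<tau>)"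
      using \<tau> eq_graph_topology countable_Gamma closed_Gamma by simp
  qed
qed

end
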